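(* Let $\mathcal{A}$ be the algebra of piecewise constant functions on $\mathbb{R}$ with $N$ fixed jump points and let $\tilde{\sigma}(\mathcal{A})\langle x_1,\dots,x_n\rangle$ be a quasi-commutative skew PBW extension of $\mathcal{A}$ whose associated automorphisms $\tilde\sigma_i$ are induced by bijections $\sigma_i:\mathbb{R}\to\mathbb{R}$ such that $\mathcal{A}$ is invariant under $\sigma_i$ and $\sigma_i^{-1}$, $1\le i\le n$. Then the centralizer $C(\mathcal{A})$ of $\mathcal{A}$ in $\tilde{\sigma}(\mathcal{A})\langle x_1,\dots,x_n\rangle$ is $$C(\mathcal{A})=\left\{\sum_{\alpha}h_{\alpha}x^{\alpha}\ :\ \mu^{-1}(h_{\alpha})=0\text{ on }Sep^{\alpha}(\Omega)\text{ for all }\alpha\in\mathbb{N}^n\right\},$$ where $\Omega=\{0,1,\dots,2N\}$ and $\mu:\mathbb{R}^{\Omega}\to\mathcal{A}$ is the isomorphism given by $\mu(f)(x)=f(\omega)$ if $x\in I_{\omega}$.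
   Context: Here $\mathbb{N}=\{0,1,2,\dots\}$. Let $t_1<\dots<t_N$ be real numbers, $t_0=-\infty$, $t_{N+1}=\infty$; put $I_k=(t_k,t_{k+1})$ for $k=0,1,\dots,N$ and $I_{N+k}=\{t_k\}$ for $k=1,\dots,N$, so that $I_0,\dots,I_{2N}$ partition $\mathbb{R}$. $\mathcal{A}$ is the algebra of functions $h:\mathbb{R}\to\mathbb{R}$ constant on each $I_k$, $0\le k\le 2N$, and $\mathbb{R}^{\Omega}$ is the algebra of all functions $\Omega\to\mathbb{R}$ (pointwise operations). The map $\mu:\mathbb{R}^{\Omega}\to\mathcal{A}$, $\mu(f)(x)=f(\omega)$ for $x\in I_\omega$, is an algebra isomorphism. $\mathcal{A}$ is invariant under a bijection $\sigma:\mathbb{R}\to\mathbb{R}$ and $\sigma^{-1}$ if $h\circ\sigma,\,h\circ\sigma^{-1}\in\mathcal{A}$ for all $h\in\mathcal{A}$; it is known that such $\sigma$ permutes the sets $I_0,\dots,I_{2N}$. For each $i$, $\tilde\sigma_i(h)=h\circ\sigma_i^{-1}$ is the automorphism of $\mathcal{A}$ induced by $\sigma_i$, and $\tau_i:\Omega\to\Omega$ is the permutation with $\tau_i(\omega)=\theta$ if and only if $\sigma_i(I_\omega)=I_\theta$. For $\alpha=(\alpha_1,\dots,\alpha_n)\in\mathbb{N}^n$, $\tau^\alpha=\tau_1^{\alpha_1}\cdots\tau_n^{\alpha_n}$ (composition) and $Sep^{\alpha}(\Omega)=\{\omega\in\Omega:\tau^{\alpha}(\omega)\neq\omega\}$.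 A quasi-commutative skew PBW extension $\tilde{\sigma}(\mathcal{A})\langle x_1,\dots,x_n\rangle$ is a ring containing $\mathcal{A}$ and elements $x_1,\dots,x_n$ such that: it is a free left $\mathcal{A}$-module with basis $\{x^{\alpha}=x_1^{\alpha_1}\cdots x_n^{\alpha_n}:\alpha\in\mathbb{N}^n\}$; $x_ih=\tilde\sigma_i(h)x_i$ for all $i$ and $h\in\mathcal{A}$; and for all $i,j$ there is $c_{i,j}\in\mathcal{A}\setminus\{0\}$ with $x_jx_i=c_{i,j}x_ix_j$. Sums $\sum_\alpha h_\alpha x^\alpha$ are finite with $h_\alpha\in\mathcal{A}$. The centralizer $C(\mathcal{A})$ is the set of elements of the extension commuting with every element of $\mathcal{A}$. *)

theory Defs
  imports "HOL-Analysis.Analysis" "HOL-Library.Function_Algebras" "HOL-Library.FuncSet"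
begin

section \<open>Piecewise constant functions\<close>

text \<open>The jump points are \<open>t 1 < \<dots> < t N\<close>; the values of \<open>t\<close> outside \<open>{1..N}\<close> are never
  used, the boundary conditions \<open>t 0 = -\<infinity>\<close> and \<open>t (N + 1) = \<infinity>\<close> being built into the formula.\<close>

definition cell :: "(nat \<Rightarrow> real) \<Rightarrow> nat \<Rightarrow> nat \<Rightarrow> real set" where
  "cell t N k =
     (if k \<le> N then {x. (k = 0 \<or> t k < x) \<and> (k = N \<or> x < t (k + 1))} else {t (k - N)})"

definition Omega :: "nat \<Rightarrow> nat set" where
  "Omega N = {0..2 * N}"

definition pw_const :: "(nat \<Rightarrow> real) \<Rightarrow> nat \<Rightarrow> (real \<Rightarrow> real) set" where
  "pw_const t N = {h. \<forall>k\<in>Omega N. h constant_on cell t N k}"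

text \<open>The algebra of all real functions on \<open>Omega N\<close> is \<open>Omega N \<rightarrow>\<^sub>E UNIV\<close>, so that
  functions agreeing on \<open>Omega N\<close> are equal and \<open>mu\<close> has an inverse.\<close>

definition mu :: "(nat \<Rightarrow> real) \<Rightarrow> nat \<Rightarrow> (nat \<Rightarrow> real) \<Rightarrow> real \<Rightarrow> real" where
  "mu t N f x = f (THE \<omega>. \<omega> \<in> Omega N \<and> x \<in> cell t N \<omega>)"

definition mu_inv :: "(nat \<Rightarrow> real) \<Rightarrow> nat \<Rightarrow> (real \<Rightarrow> real) \<Rightarrow> nat \<Rightarrow> real" where
  "mu_inv t N = the_inv_into (Omega N \<rightarrow>\<^sub>E UNIV) (mu t N)"

section \<open>Bijections of the line and their action\<close>

definition invariant_under :: "(real \<Rightarrow> real) set \<Rightarrow> (real \<Rightarrow> real) \<Rightarrow> bool" where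
  "invariant_under A \<sigma> \<longleftrightarrow> (\<forall>h\<in>A. h \<circ> \<sigma> \<in> A \<and> h \<circ> inv \<sigma> \<in> A)"

definition induced_aut :: "(real \<Rightarrow> real) \<Rightarrow> (real \<Rightarrow> real) \<Rightarrow> real \<Rightarrow> real" where
  "induced_aut \<sigma> h = h \<circ> inv \<sigma>"

definition cell_perm :: "(nat \<Rightarrow> real) \<Rightarrow> nat \<Rightarrow> (real \<Rightarrow> real) \<Rightarrow> nat \<Rightarrow> nat" where
  "cell_perm t N \<sigma> \<omega> =
     (if \<omega> \<in> Omega N then (THE \<theta>. \<theta> \<in> Omega N \<and> \<sigma> ` cell t N \<omega> = cell t N \<theta>) else \<omega>)"

definition multi_indices :: "nat \<Rightarrow> (nat \<Rightarrow> nat) set" where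
  "multi_indices n = {1..n} \<rightarrow>\<^sub>E UNIV"

text \<open>The composition \<open>\<tau> 1 ^^ \<alpha> 1 \<circ> \<dots> \<circ> \<tau> n ^^ \<alpha> n\<close>.\<close>

definition comp_power :: "nat \<Rightarrow> (nat \<Rightarrow> 'b \<Rightarrow> 'b) \<Rightarrow> (nat \<Rightarrow> nat) \<Rightarrow> 'b \<Rightarrow> 'b" where
  "comp_power n \<tau> \<alpha> = foldr (\<circ>) (map (\<lambda>i. \<tau> i ^^ \<alpha> i) [1..<n + 1]) id"

definition Sep :: "(nat \<Rightarrow> real) \<Rightarrow> nat \<Rightarrow> nat \<Rightarrow> (nat \<Rightarrow> real \<Rightarrow> real) \<Rightarrow> (nat \<Rightarrow> nat) \<Rightarrow> nat set" where
  "Sep t N n \<sigma> \<alpha> = {\<omega> \<in> Omega N. comp_power n (\<lambda>i. cell_perm t N (\<sigma> i)) \<alpha> \<omega> \<noteq> \<omega>}"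

section \<open>Quasi-commutative skew PBW extensions\<close>

text \<open>The factors of the monomial occur in increasing order of the variables.\<close>

definition pbw_monom :: "nat \<Rightarrow> (nat \<Rightarrow> 'r::ring_1) \<Rightarrow> (nat \<Rightarrow> nat) \<Rightarrow> 'r" where
  "pbw_monom n x \<alpha> = prod_list (map (\<lambda>i. x i ^ \<alpha> i) [1..<n + 1])"

definition coeff_families :: "'a::zero set \<Rightarrow> nat \<Rightarrow> ((nat \<Rightarrow> nat) \<Rightarrow> 'a) set" where
  "coeff_families A n =
     {h. (\<forall>\<alpha>. h \<alpha> \<in> A) \<and> finite {\<alpha>. h \<alpha> \<noteq> 0} \<and> {\<alpha>. h \<alpha> \<noteq> 0} \<subseteq> multi_indices n}"

definition pbw_sum ::
  "nat \<Rightarrow> ('a::zero \<Rightarrow> 'r::ring_1) \<Rightarrow> (nat \<Rightarrow> 'r) \<Rightarrow> ((nat \<Rightarrow> nat) \<Rightarrow> 'a) \<Rightarrow> 'r" where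
  "pbw_sum n \<iota> x h = (\<Sum>\<alpha> | h \<alpha> \<noteq> 0. \<iota> (h \<alpha>) * pbw_monom n x \<alpha>)"

text \<open>Here \<open>A\<close> is a subring of the type \<open>'a\<close>; the extension is the type \<open>'r\<close>, which contains
  \<open>A\<close> by means of the embedding \<open>\<iota>\<close>, a map whose values outside \<open>A\<close> are irrelevant. The
  assumptions \<open>spanning\<close> and \<open>independent\<close> say that the family of monomials is a basis of \<open>'r\<close>
  as a left \<open>A\<close>-module.\<close>

locale quasi_comm_skew_PBW =
  fixes A :: "'a::ring_1 set"
    and n :: nat
    and s :: "nat \<Rightarrow> 'a \<Rightarrow> 'a"
    and \<iota> :: "'a \<Rightarrow> 'r::ring_1"
    and x :: "nat \<Rightarrow> 'r"
  assumes embed_inj: "inj_on \<iota> A"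
    and embed_one: "\<iota> 1 = 1"
    and embed_add: "\<And>a b. a \<in> A \<Longrightarrow> b \<in> A \<Longrightarrow> \<iota> (a + b) = \<iota> a + \<iota> b"
    and embed_mult: "\<And>a b. a \<in> A \<Longrightarrow> b \<in> A \<Longrightarrow> \<iota> (a * b) = \<iota> a * \<iota> b"
    and spanning: "\<And>r. \<exists>h\<in>coeff_families A n. r = pbw_sum n \<iota> x h"
    and independent: "\<And>h. h \<in> coeff_families A n \<Longrightarrow> pbw_sum n \<iota> x h = 0 \<Longrightarrow> \<forall>\<alpha>. h \<alpha> = 0"
    and skew: "\<And>i a. i \<in> {1..n} \<Longrightarrow> a \<in> A \<Longrightarrow> x i * \<iota> a = \<iota> (s i a) * x i"
    and quasi_comm: "\<And>i j. i \<in> {1..n} \<Longrightarrow> j \<in> {1..n} \<Longrightarrow>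
      \<exists>c\<in>A - {0}. x j * x i = \<iota> c * x i * x j"

definition centralizer :: "'r::ring_1 set \<Rightarrow> 'r set" where
  "centralizer S = {r. \<forall>s\<in>S. r * s = s * r}"

end

(* Moving a past a monomial gives x^alpha a = s^alpha(a) x^alpha with s^alpha(a) = a o (sigma^alpha)^-1,
   so, the monomials being a basis, sum h_alpha x^alpha centralizes A iff
   h_alpha * (a o (sigma^alpha)^-1 - a) = 0 for all alpha and all a in A.
   A consists of the functions that factor through the map sending a point to the index of its
   cell, and this map intertwines sigma^alpha with tau^alpha. Testing with the indicator functions
   of the cells shows that the condition says exactly that h_alpha vanishes on the cells moved by
   tau^alpha. *)
theory Submission
  imports Defs
begin

section \<open>Cells\<close>

context
  fixes t :: "nat \<Rightarrow> real" and N :: nat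
  assumes t_mono: "strict_mono_on {1..N} t"
begin

lemma t_less: "1 \<le> i \<Longrightarrow> i < j \<Longrightarrow> j \<le> N \<Longrightarrow> t i < t j"
  using strict_mono_onD[OF t_mono, of i j] by simp

lemma t_le: "1 \<le> i \<Longrightarrow> i \<le> j \<Longrightarrow> j \<le> N \<Longrightarrow> t i \<le> t j"
  using t_less[of i j] by (cases "i = j") auto

text \<open>A point that is not a jump point lies in the interval whose left end is the last
  \<open>t k\<close> below it.\<close>

lemma cell_cover: "\<exists>\<omega>\<in>Omega N. y \<in> cell t N \<omega>"
proof (cases "\<exists>j\<in>{1..N}. y = t j")
  case True
  then obtain j where "j \<in> {1..N}" "y = t j" by blast
  then show ?thesis by (intro bexI[of _ "N + j"]) (auto simp: Omega_def cell_def)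
next
  case False
  \<comment> \<open>The index 0 belongs to \<open>S\<close> unconditionally, in the role of t_0 =
    -infinity, so the maximum exists for every \<open>y\<close>.\<close>
  define S where "S = {k. k \<le> N \<and> (k = 0 \<or> t k < y)}"
  have fin: "finite S" by (rule finite_subset[of _ "{..N}"]) (auto simp: S_def)
  have "0 \<in> S" by (simp add: S_def)
  define k where "k = Max S"
  have k: "k \<in> S" using Max_in[OF fin] \<open>0 \<in> S\<close> by (auto simp: k_def)
  have "y < t (k + 1)" if "k \<noteq> N"
  proof -
    have "k + 1 \<notin> S" using Max_ge[OF fin, of "k + 1"] by (auto simp: k_def)
    moreover have "k + 1 \<in> {1..N}" using k that by (simp add: S_def)
    moreover from this have "y \<noteq> t (k + 1)" using False by blast
    ultimately show ?thesis by (auto simp: S_def)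
  qed
  then have "y \<in> cell t N k" using k by (auto simp: S_def cell_def)
  then show ?thesis using k by (intro bexI[of _ k]) (auto simp: S_def Omega_def)
qed

text \<open>Jump points are numbered after all intervals, so \<open>k < l\<close> leaves three
  cases: two intervals, an interval and a jump point, two jump points. Each contradicts the
  monotonicity of \<open>t\<close>.\<close>

lemma cell_disjoint_aux:
  assumes "k \<in> Omega N" "l \<in> Omega N" "y \<in> cell t N k" "y \<in> cell t N l" "k < l"
  shows False
proof -
  consider "l \<le> N" | "k \<le> N" "N < l" | "N < k" by linarith
  then show False
  proof cases
    case 1
    then have "y < t (k + 1)" "t l < y" using assms by (auto simp: cell_def)
    then show False using t_le[of "k + 1" l] 1 assms(5) by simp
  next
    case 2
    define j where "j = l - N"
    have j: "1 \<le> j" "j \<le> N" "y = t j" using 2 assms by (auto simp: j_def cell_def Omega_def)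
    have y: "k = 0 \<or> t k < y" "k = N \<or> y < t (k + 1)" using 2 assms by (auto simp: cell_def)
    show False
    proof (cases "j \<le> k")
      case True
      then show False using y j 2 t_le[of j k] by auto
    next
      case False
      then show False using y j t_le[of "k + 1" j] by auto
    qed
  next
    case 3
    then have "t (k - N) = t (l - N)" using assms by (auto simp: cell_def)
    moreover have "1 \<le> k - N" "k - N < l - N" "l - N \<le> N" using 3 assms by (auto simp: Omega_def)
    ultimately show False using t_less[of "k - N" "l - N"] by simp
  qed
qed

lemma cell_unique:
  assumes "k \<in> Omega N" "l \<in> Omega N" "y \<in> cell t N k" "y \<in> cell t N l"
  shows "k = l"
  using cell_disjoint_aux[OF assms] cell_disjoint_aux[OF assms(2,1,4,3)] by (meson linorder_neqE_nat)

lemma cell_nonempty: "cell t N k \<noteq> {}"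
proof -
  consider "N < k" | "k = N" | "k = 0" "k < N" | "1 \<le> k" "k < N" by linarith
  then have "\<exists>y. y \<in> cell t N k"
  proof cases
    \<comment> \<open>For \<open>N = 0\<close> this case is also \<open>k = 0\<close>: the cell is
      then the whole line, so the unspecified value \<open>t 0\<close> is harmless.\<close>
    case 2 then show ?thesis by (intro exI[of _ "t N + 1"]) (simp add: cell_def)
  next
    case 3 then show ?thesis by (intro exI[of _ "t 1 - 1"]) (simp add: cell_def)
  next
    case 4
    then obtain y where "t k < y" "y < t (k + 1)" using dense[OF t_less[of k "k + 1"]] by auto
    then show ?thesis using 4 by (auto simp: cell_def)
  qed (auto simp: cell_def)
  then show ?thesis by blast
qed

text \<open>The quotient map of the line whose fibres are the cells. It turns arguments about cells
  as sets into equations between indices.\<close>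

definition cell_index :: "real \<Rightarrow> nat" where
  "cell_index y = (THE \<omega>. \<omega> \<in> Omega N \<and> y \<in> cell t N \<omega>)"

lemma cell_index_eqI: "\<omega> \<in> Omega N \<Longrightarrow> y \<in> cell t N \<omega> \<Longrightarrow> cell_index y = \<omega>"
  unfolding cell_index_def by (blast intro: cell_unique)

lemma cell_index_in: "cell_index y \<in> Omega N"
  and in_cell_index: "y \<in> cell t N (cell_index y)"
  using cell_cover[of y] cell_index_eqI[of _ y] by auto

lemma cell_eq: "\<omega> \<in> Omega N \<Longrightarrow> cell t N \<omega> = {y. cell_index y = \<omega>}"
  using cell_index_eqI in_cell_index by blast

lemma cell_index_surj: "\<omega> \<in> Omega N \<Longrightarrow> \<exists>y. cell_index y = \<omega>"
  using cell_nonempty[of \<omega>] cell_index_eqI by blast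

section \<open>Piecewise constant functions\<close>

lemma pw_const_iff: "h \<in> pw_const t N \<longleftrightarrow> (\<forall>y z. cell_index y = cell_index z \<longrightarrow> h y = h z)"
proof
  assume h: "h \<in> pw_const t N"
  show "\<forall>y z. cell_index y = cell_index z \<longrightarrow> h y = h z"
  proof (intro allI impI)
    fix y z assume "cell_index y = cell_index z"
    moreover have "h constant_on cell t N (cell_index y)"
      using h cell_index_in by (simp add: pw_const_def)
    ultimately show "h y = h z"
      using in_cell_index[of y] in_cell_index[of z] unfolding constant_on_def by metis
  qed
next
  assume "\<forall>y z. cell_index y = cell_index z \<longrightarrow> h y = h z"
  then show "h \<in> pw_const t N"
    unfolding pw_const_def constant_on_def mem_Collect_eq using cell_eq cell_index_surj by blast
qed

lemma pw_constD: "h \<in> pw_const t N \<Longrightarrow> cell_index y = cell_index z \<Longrightarrow> h y = h z"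
  unfolding pw_const_iff by blast

text \<open>These are the test functions of the proof: they lie in the algebra and tell any two
  cells apart.\<close>

lemma indicator_cell_pw_const: "(\<lambda>y. of_bool (cell_index y = \<omega>)) \<in> pw_const t N"
  by (simp add: pw_const_iff)

lemma mu_eq: "mu t N f y = f (cell_index y)"
  by (simp add: mu_def cell_index_def)

lemma mu_inv_cell_index:
  assumes "h \<in> pw_const t N"
  shows "mu_inv t N h (cell_index y) = h y"
proof -
  have inj: "inj_on (mu t N) (Omega N \<rightarrow>\<^sub>E UNIV)"
  proof (rule inj_onI)
    fix f g assume fg: "f \<in> Omega N \<rightarrow>\<^sub>E UNIV" "g \<in> Omega N \<rightarrow>\<^sub>E UNIV" "mu t N f = mu t N g"
    show "f = g"
      using fg(1,2)
    proof (rule PiE_ext)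
      fix \<omega> assume "\<omega> \<in> Omega N"
      then obtain z where "cell_index z = \<omega>" using cell_index_surj by blast
      then show "f \<omega> = g \<omega>" using fun_cong[OF fg(3), of z] by (simp add: mu_eq)
    qed
  qed
  \<comment> \<open>The choice of \<open>z\<close> is immaterial because \<open>h\<close> is
    constant on cells; \<open>restrict\<close> puts \<open>f\<close> into the extensional function
    space on which \<open>mu\<close> is inverted.\<close>
  define f where "f = restrict (\<lambda>\<omega>. h (SOME z. cell_index z = \<omega>)) (Omega N)"
  have f: "f \<in> Omega N \<rightarrow>\<^sub>E UNIV" by (simp add: f_def)
  have val: "f (cell_index z) = h z" for z
  proof -
    have "cell_index (SOME w. cell_index w = cell_index z) = cell_index z"
      by (rule someI[of _ z]) simp
    then have "h (SOME w. cell_index w = cell_index z) = h z"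
      by (rule pw_constD[OF assms])
    then show ?thesis by (simp add: f_def cell_index_in)
  qed
  have "mu t N f = h" by (rule ext) (simp add: mu_eq val)
  then have "mu_inv t N h = f" unfolding mu_inv_def using the_inv_into_f_f[OF inj f] by simp
  then show ?thesis by (simp add: val)
qed

section \<open>The action of the bijections on cells\<close>

text \<open>The indicator of a cell composed with \<open>\<sigma>\<close> is still constant on
  cells, so \<open>\<sigma>\<close> cannot send one cell into two; the same argument for
  \<open>inv \<sigma>\<close> gives the converse.\<close>

lemma cell_index_invariant:
  assumes "bij \<sigma>" "invariant_under (pw_const t N) \<sigma>"
  shows "cell_index (\<sigma> y) = cell_index (\<sigma> z) \<longleftrightarrow> cell_index y = cell_index z"
proof
  have inv_comp: "h \<circ> \<sigma> \<in> pw_const t N" "h \<circ> inv \<sigma> \<in> pw_const t N" if "h \<in> pw_const t N" for h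
    using assms(2) that by (auto simp: invariant_under_def)
  {
    assume eq: "cell_index (\<sigma> y) = cell_index (\<sigma> z)"
    have "(of_bool (cell_index (inv \<sigma> (\<sigma> y)) = cell_index z) :: real)
        = of_bool (cell_index (inv \<sigma> (\<sigma> z)) = cell_index z)"
      using inv_comp(2)[OF indicator_cell_pw_const[of "cell_index z"]] eq
      unfolding o_def by (rule pw_constD)
    then show "cell_index y = cell_index z"
      using bij_is_inj[OF assms(1)] by simp
  next
    assume eq: "cell_index y = cell_index z"
    have "(of_bool (cell_index (\<sigma> y) = cell_index (\<sigma> z)) :: real)
        = of_bool (cell_index (\<sigma> z) = cell_index (\<sigma> z))"
      using inv_comp(1)[OF indicator_cell_pw_const[of "cell_index (\<sigma> z)"]] eq
      unfolding o_def by (rule pw_constD)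
    then show "cell_index (\<sigma> y) = cell_index (\<sigma> z)"
      by simp
  }
qed

text \<open>By invariance \<open>\<sigma>\<close> maps fibres of \<open>cell_index\<close> onto
  fibres. The index of the image is unique, since \<open>\<sigma> y\<close> lies in only one
  cell.\<close>

lemma cell_perm_cell_index:
  assumes "bij \<sigma>" "invariant_under (pw_const t N) \<sigma>"
  shows "cell_perm t N \<sigma> (cell_index y) = cell_index (\<sigma> y)"
proof -
  have img: "\<sigma> ` cell t N (cell_index y) = cell t N (cell_index (\<sigma> y))"
  proof -
    have "\<sigma> ` {z. cell_index z = cell_index y} = {z. cell_index z = cell_index (\<sigma> y)}"
    proof (intro equalityI subsetI)
      fix z assume "z \<in> {z. cell_index z = cell_index (\<sigma> y)}"
      moreover have "\<sigma> (inv \<sigma> z) = z" using assms(1) by (simp add: bij_is_surj surj_f_inv_f)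
      ultimately show "z \<in> \<sigma> ` {z. cell_index z = cell_index y}"
        using cell_index_invariant[OF assms, of "inv \<sigma> z" y] by (intro image_eqI[of _ _ "inv \<sigma> z"]) auto
    qed (auto simp: cell_index_invariant[OF assms])
    then show ?thesis by (simp add: cell_eq cell_index_in)
  qed
  have "(THE \<theta>. \<theta> \<in> Omega N \<and> \<sigma> ` cell t N (cell_index y) = cell t N \<theta>) = cell_index (\<sigma> y)"
  proof (rule the_equality)
    fix \<theta> assume \<theta>: "\<theta> \<in> Omega N \<and> \<sigma> ` cell t N (cell_index y) = cell t N \<theta>"
    then show "\<theta> = cell_index (\<sigma> y)"
      using in_cell_index[of "\<sigma> y"] cell_index_eqI img by metis
  qed (simp add: img cell_index_in)
  then show ?thesis by (simp add: cell_perm_def cell_index_in)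
qed

end

section \<open>Composite maps along a multi-index and the separation condition\<close>

text \<open>Transfers a relation from single maps to composites with equal exponents, adding one
  factor on the left at a time. It serves to compare the bijections with their automorphisms and
  with their permutations of cells.\<close>

lemma comp_power_induct2:
  assumes "P id id"
    and step: "\<And>i f g. i \<in> {1..n} \<Longrightarrow> P f g \<Longrightarrow> P (\<tau> i \<circ> f) (\<rho> i \<circ> g)"
  shows "P (comp_power n \<tau> \<alpha>) (comp_power n \<rho> \<alpha>)"
proof -
  have pow: "P ((\<tau> i ^^ k) \<circ> f) ((\<rho> i ^^ k) \<circ> g)" if "i \<in> {1..n}" "P f g" for i k f g
  proof (induction k)
    case (Suc k)
    then show ?case using step[OF that(1)] by (simp only: funpow.simps comp_assoc)
  qed (use that(2) in simp)
  have "P (foldr (\<circ>) (map (\<lambda>i. \<tau> i ^^ \<alpha> i) is) id) (foldr (\<circ>) (map (\<lambda>i. \<rho> i ^^ \<alpha> i) is) id)"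
    if "set is \<subseteq> {1..n}" for "is"
    using that by (induction "is") (auto simp: assms(1) intro: pow)
  moreover have "set [1..<n + 1] \<subseteq> {1..n}" by auto
  ultimately show ?thesis unfolding comp_power_def by blast
qed

text \<open>The passage from \<open>\<sigma>\<close> to \<open>induced_aut \<sigma>\<close>
  preserves the order of composition: inversion reverses it, and so does precomposition. Bijectivity
  is carried along because inverting a composite requires it.\<close>

lemma comp_power_induced_aut:
  assumes "\<And>i. i \<in> {1..n} \<Longrightarrow> bij (\<sigma> i)"
  shows "bij (comp_power n \<sigma> \<alpha>)"
    and "comp_power n (\<lambda>i. induced_aut (\<sigma> i)) \<alpha> = induced_aut (comp_power n \<sigma> \<alpha>)"
proof -
  have "bij (comp_power n \<sigma> \<alpha>) \<and>
      comp_power n (\<lambda>i. induced_aut (\<sigma> i)) \<alpha> = induced_aut (comp_power n \<sigma> \<alpha>)"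
    by (rule comp_power_induct2[where P = "\<lambda>f g. bij f \<and> g = induced_aut f"])
      (auto simp: assms bij_comp induced_aut_def fun_eq_iff o_inv_distrib)
  then show "bij (comp_power n \<sigma> \<alpha>)"
    and "comp_power n (\<lambda>i. induced_aut (\<sigma> i)) \<alpha> = induced_aut (comp_power n \<sigma> \<alpha>)" by auto
qed

lemma cell_index_comp_power:
  assumes t: "strict_mono_on {1..N} t" and "\<And>i. i \<in> {1..n} \<Longrightarrow> bij (\<sigma> i)"
    and "\<And>i. i \<in> {1..n} \<Longrightarrow> invariant_under (pw_const t N) (\<sigma> i)"
  shows "cell_index t N (comp_power n \<sigma> \<alpha> y) =
      comp_power n (\<lambda>i. cell_perm t N (\<sigma> i)) \<alpha> (cell_index t N y)"
    and "cell_index t N (comp_power n \<sigma> \<alpha> y) = cell_index t N (comp_power n \<sigma> \<alpha> z) \<longleftrightarrow>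
      cell_index t N y = cell_index t N z"
proof -
  show "cell_index t N (comp_power n \<sigma> \<alpha> y) =
      comp_power n (\<lambda>i. cell_perm t N (\<sigma> i)) \<alpha> (cell_index t N y)"
    by (rule comp_power_induct2[where P = "\<lambda>f g. cell_index t N (f y) = g (cell_index t N y)"])
      (use cell_perm_cell_index[OF t, symmetric] assms in auto)
  show "cell_index t N (comp_power n \<sigma> \<alpha> y) = cell_index t N (comp_power n \<sigma> \<alpha> z) \<longleftrightarrow>
      cell_index t N y = cell_index t N z"
    by (rule comp_power_induct2[where P = "\<lambda>f g. cell_index t N (f y) = cell_index t N (f z) \<longleftrightarrow>
          cell_index t N y = cell_index t N z"])
      (use cell_index_invariant[OF t] assms in auto)
qed

text \<open>At a point y the right side says h(y) a(p^-1(y)) = a(y) h(y), where p is the composite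
  bijection. This is automatic when y and p^-1(y) share a cell; otherwise a suitable
  \<open>a\<close> forces h(y) = 0.\<close>

lemma vanishes_on_Sep_iff:
  assumes t: "strict_mono_on {1..N} t" and bij: "\<And>i. i \<in> {1..n} \<Longrightarrow> bij (\<sigma> i)"
    and invar: "\<And>i. i \<in> {1..n} \<Longrightarrow> invariant_under (pw_const t N) (\<sigma> i)"
    and h: "h \<in> pw_const t N"
  shows "(\<forall>\<omega>\<in>Sep t N n \<sigma> \<alpha>. mu_inv t N h \<omega> = 0) \<longleftrightarrow>
    (\<forall>a\<in>pw_const t N. h * comp_power n (\<lambda>i. induced_aut (\<sigma> i)) \<alpha> a = a * h)"
    (is "?L \<longleftrightarrow> ?R")
proof -
  let ?c = "cell_index t N"
  note c_comp = cell_index_comp_power[OF t, where n = n and \<sigma> = \<sigma> and \<alpha> = \<alpha>, OF bij invar]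
  define p where "p = comp_power n \<sigma> \<alpha>"
  have s: "comp_power n (\<lambda>i. induced_aut (\<sigma> i)) \<alpha> = induced_aut p"
    using comp_power_induced_aut(2)[OF bij] by (simp add: p_def)
  have p_inv: "p (inv p y) = y" for y
    using comp_power_induced_aut(1)[OF bij] by (simp add: p_def bij_is_surj surj_f_inv_f)
  \<comment> \<open>The automorphism involves the inverse of \<open>p\<close>, whereas
    \<open>Sep\<close> involves \<open>p\<close> itself; both move the same cells.\<close>
  have c_inv_iff: "?c (inv p y) = ?c y \<longleftrightarrow> ?c (p y) = ?c y" for y
    using c_comp(2)[of "inv p y" y] p_inv[of y]
    by (auto simp: p_def)
  have Sep: "Sep t N n \<sigma> \<alpha> = ?c ` {y. ?c (p y) \<noteq> ?c y}"
  proof (intro equalityI subsetI)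
    fix \<omega> assume \<omega>: "\<omega> \<in> Sep t N n \<sigma> \<alpha>"
    then obtain y where "?c y = \<omega>" using cell_index_surj[OF t] by (auto simp: Sep_def)
    then show "\<omega> \<in> ?c ` {y. ?c (p y) \<noteq> ?c y}"
      using \<omega> c_comp(1)[of y] by (auto simp: Sep_def p_def)
  qed (use c_comp(1) in
      \<open>auto simp: Sep_def p_def cell_index_in[OF t]\<close>)
  have "?L \<longleftrightarrow> (\<forall>y. ?c (inv p y) \<noteq> ?c y \<longrightarrow> h y = 0)"
    using mu_inv_cell_index[OF t h] by (auto simp: Sep c_inv_iff)
  also have "\<dots> \<longleftrightarrow> ?R"
  proof
    assume *: "\<forall>y. ?c (inv p y) \<noteq> ?c y \<longrightarrow> h y = 0"
    show ?R unfolding s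
    proof
      fix a assume "a \<in> pw_const t N"
      then have "a (inv p y) = a y \<or> h y = 0" for y
        using * pw_constD[OF t] by blast
      then have "h y * a (inv p y) = a y * h y" for y
        by (metis mult.commute mult_zero_left)
      then show "h * induced_aut p a = a * h"
        by (simp add: fun_eq_iff induced_aut_def)
    qed
  next
    assume R: ?R
    show "\<forall>y. ?c (inv p y) \<noteq> ?c y \<longrightarrow> h y = 0"
    proof (intro allI impI)
      fix y assume y: "?c (inv p y) \<noteq> ?c y"
      \<comment> \<open>The indicator of the cell of \<open>y\<close> is 0 at \<open>inv p y\<close>
        and 1 at \<open>y\<close>, so the equation at \<open>y\<close> reads 0 = h(y).\<close>
      have "h * induced_aut p (\<lambda>z. of_bool (?c z = ?c y)) = (\<lambda>z. of_bool (?c z = ?c y)) * h"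
        using R indicator_cell_pw_const[OF t] unfolding s by blast
      from fun_cong[OF this, of y] show "h y = 0" using y by (simp add: induced_aut_def)
    qed
  qed
  finally show ?thesis .
qed

section \<open>Elements commuting with the coefficients\<close>

context quasi_comm_skew_PBW
begin

text \<open>Membership in \<open>A\<close> is part of the induction because \<open>skew\<close>
  applies only to elements of \<open>A\<close>.\<close>

lemma pow_skew:
  assumes "\<And>a. a \<in> A \<Longrightarrow> s i a \<in> A" "i \<in> {1..n}" "a \<in> A"
  shows "(s i ^^ k) a \<in> A \<and> x i ^ k * \<iota> a = \<iota> ((s i ^^ k) a) * x i ^ k"
proof (induction k)
  case (Suc k)
  have "x i ^ Suc k * \<iota> a = x i * (x i ^ k * \<iota> a)" by (simp add: mult.assoc)
  also have "\<dots> = (x i * \<iota> ((s i ^^ k) a)) * x i ^ k" using Suc by (simp add: mult.assoc)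
  also have "\<dots> = \<iota> ((s i ^^ Suc k) a) * x i ^ Suc k"
    using skew[OF assms(2), of "(s i ^^ k) a"] Suc by (simp add: mult.assoc)
  finally show ?case using Suc assms by simp
qed (use assms in simp)

text \<open>The coefficient passes the last variable first, so the automorphism with the largest
  index acts innermost, as in \<open>comp_power\<close>.\<close>

lemma monom_skew:
  assumes s: "\<And>i a. i \<in> {1..n} \<Longrightarrow> a \<in> A \<Longrightarrow> s i a \<in> A" and a: "a \<in> A"
  shows "comp_power n s \<alpha> a \<in> A"
    and "pbw_monom n x \<alpha> * \<iota> a = \<iota> (comp_power n s \<alpha> a) * pbw_monom n x \<alpha>"
proof -
  let ?S = "\<lambda>is. foldr (\<circ>) (map (\<lambda>i. s i ^^ \<alpha> i) is) id a"
  let ?X = "\<lambda>is. prod_list (map (\<lambda>i. x i ^ \<alpha> i) is)"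
  \<comment> \<open>The claim is generalised from \<open>[1..<n + 1]\<close> to arbitrary lists of
    variables to allow list induction.\<close>
  have "?S is \<in> A \<and> ?X is * \<iota> a = \<iota> (?S is) * ?X is" if "set is \<subseteq> {1..n}" for "is"
    using that
  proof (induction "is")
    case (Cons i "is")
    then have i: "i \<in> {1..n}" and "set is \<subseteq> {1..n}" by simp_all
    then have IH: "?S is \<in> A" "?X is * \<iota> a = \<iota> (?S is) * ?X is" using Cons.IH by blast+
    have S_Cons: "?S (i # is) = (s i ^^ \<alpha> i) (?S is)" by (simp add: comp_def)
    note ps = pow_skew[OF s[OF i] i IH(1), of "\<alpha> i"]
    have "?X (i # is) * \<iota> a = (x i ^ \<alpha> i * \<iota> (?S is)) * ?X is"
      using IH(2) by (simp add: mult.assoc)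
    also have "\<dots> = \<iota> (?S (i # is)) * ?X (i # is)" using ps unfolding S_Cons by (simp add: mult.assoc)
    finally show ?case using ps unfolding S_Cons by simp
  qed (use a in simp)
  moreover have "set [1..<n + 1] \<subseteq> {1..n}" by auto
  ultimately show "comp_power n s \<alpha> a \<in> A"
    and "pbw_monom n x \<alpha> * \<iota> a = \<iota> (comp_power n s \<alpha> a) * pbw_monom n x \<alpha>"
    unfolding comp_power_def pbw_monom_def by blast+
qed

text \<open>The commutator of the sum with \<open>\<iota> a\<close> is again a sum over monomials,
  with coefficients \<open>d \<alpha>\<close>; by independence it vanishes only if all of them
  do.\<close>

lemma commute_coefficient_iff:
  assumes diff: "\<And>a b. a \<in> A \<Longrightarrow> b \<in> A \<Longrightarrow> a - b \<in> A"
    and mult: "\<And>a b. a \<in> A \<Longrightarrow> b \<in> A \<Longrightarrow> a * b \<in> A"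
    and s: "\<And>i a. i \<in> {1..n} \<Longrightarrow> a \<in> A \<Longrightarrow> s i a \<in> A"
    and h: "h \<in> coeff_families A n" and a: "a \<in> A"
  shows "pbw_sum n \<iota> x h * \<iota> a = \<iota> a * pbw_sum n \<iota> x h \<longleftrightarrow>
    (\<forall>\<alpha>. h \<alpha> * comp_power n s \<alpha> a = a * h \<alpha>)"
proof -
  let ?M = "pbw_monom n x"
  define S where "S = {\<alpha>. h \<alpha> \<noteq> 0}"
  define d where "d \<alpha> = h \<alpha> * comp_power n s \<alpha> a - a * h \<alpha>" for \<alpha>
  have hA: "h \<alpha> \<in> A" for \<alpha> using h by (simp add: coeff_families_def)
  have S: "finite S" "S \<subseteq> multi_indices n" using h by (auto simp: coeff_families_def S_def)
  have sA: "comp_power n s \<alpha> a \<in> A" for \<alpha> using monom_skew(1)[OF s a] .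
  have M: "?M \<alpha> * \<iota> a = \<iota> (comp_power n s \<alpha> a) * ?M \<alpha>" for \<alpha>
    using monom_skew(2)[OF s a] .
  have "0 \<in> A" using diff[OF a a] by simp
  then have embed_zero: "\<iota> 0 = 0" using embed_add[of 0 0] by simp
  have dA: "d \<alpha> \<in> A" for \<alpha> unfolding d_def by (intro diff mult hA sA a)
  have embed_d: "\<iota> (d \<alpha>) = \<iota> (h \<alpha>) * \<iota> (comp_power n s \<alpha> a) - \<iota> a * \<iota> (h \<alpha>)" for \<alpha>
    \<comment> \<open>Compatibility of \<open>\<iota>\<close> with subtraction comes from additivity
      applied to \<open>d \<alpha> + a * h \<alpha>\<close>.\<close>
    using embed_add[OF dA mult[OF a hA], of \<alpha> \<alpha>] embed_mult hA sA a
    by (simp add: d_def eq_diff_eq)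
  have sub: "{\<alpha>. d \<alpha> \<noteq> 0} \<subseteq> S" by (auto simp: d_def S_def)
  have d: "d \<in> coeff_families A n"
    using sub S dA by (auto simp: coeff_families_def intro: finite_subset)
  have "pbw_sum n \<iota> x h * \<iota> a - \<iota> a * pbw_sum n \<iota> x h
      = (\<Sum>\<alpha>\<in>S. \<iota> (h \<alpha>) * (?M \<alpha> * \<iota> a)) - (\<Sum>\<alpha>\<in>S. \<iota> a * \<iota> (h \<alpha>) * ?M \<alpha>)"
    by (simp add: pbw_sum_def S_def sum_distrib_left sum_distrib_right mult.assoc)
  also have "\<dots> = (\<Sum>\<alpha>\<in>S. \<iota> (d \<alpha>) * ?M \<alpha>)"
    by (simp add: sum_subtractf[symmetric] embed_d M left_diff_distrib mult.assoc)
  also have "\<dots> = pbw_sum n \<iota> x d"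
    \<comment> \<open>The support of \<open>d\<close> may be smaller than that of \<open>h\<close>;
      the additional terms vanish because \<open>\<iota> 0 = 0\<close>.\<close>
    unfolding pbw_sum_def by (rule sum.mono_neutral_right[OF S(1) sub]) (auto simp: embed_zero)
  finally have "pbw_sum n \<iota> x h * \<iota> a = \<iota> a * pbw_sum n \<iota> x h \<longleftrightarrow> pbw_sum n \<iota> x d = 0"
    by (metis right_minus_eq)
  also have "\<dots> \<longleftrightarrow> (\<forall>\<alpha>. d \<alpha> = 0)"
  proof
    assume "\<forall>\<alpha>. d \<alpha> = 0"
    then have "{\<alpha>. d \<alpha> \<noteq> 0} = {}" by blast
    then show "pbw_sum n \<iota> x d = 0" by (simp only: pbw_sum_def sum.empty)
  qed (rule independent[OF d])
  finally show ?thesis by (simp only: d_def right_minus_eq)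
qed

end

section \<open>Determination of the centralizer\<close>

theorem theorem7:
  fixes N n :: nat
    and t :: "nat \<Rightarrow> real"
    and \<sigma> :: "nat \<Rightarrow> real \<Rightarrow> real"
    and \<iota> :: "(real \<Rightarrow> real) \<Rightarrow> 'r::ring_1"
    and x :: "nat \<Rightarrow> 'r"
  assumes "strict_mono_on {1..N} t"
    and "\<And>i. i \<in> {1..n} \<Longrightarrow> bij (\<sigma> i)"
    and "\<And>i. i \<in> {1..n} \<Longrightarrow> invariant_under (pw_const t N) (\<sigma> i)"
    and "quasi_comm_skew_PBW (pw_const t N) n (\<lambda>i. induced_aut (\<sigma> i)) \<iota> x"
  shows "centralizer (\<iota> ` pw_const t N) =
    {pbw_sum n \<iota> x h | h. h \<in> coeff_families (pw_const t N) n \<and>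
       (\<forall>\<alpha>\<in>multi_indices n. \<forall>\<omega>\<in>Sep t N n \<sigma> \<alpha>. mu_inv t N (h \<alpha>) \<omega> = 0)}"
proof -
  let ?A = "pw_const t N"
  interpret quasi_comm_skew_PBW ?A n "\<lambda>i. induced_aut (\<sigma> i)" \<iota> x by fact
  note pw = pw_const_iff[OF assms(1)]
  have ring: "a - b \<in> ?A" "a * b \<in> ?A" if "a \<in> ?A" "b \<in> ?A" for a b
    using that unfolding pw minus_apply times_fun_def by metis+
  have aut: "induced_aut (\<sigma> i) a \<in> ?A" if "i \<in> {1..n}" "a \<in> ?A" for i a
    using assms(3) that by (simp add: invariant_under_def induced_aut_def)
  \<comment> \<open>By \<open>spanning\<close> every ring element is such a sum, so deciding
    membership for these sums suffices.\<close>
  have key: "pbw_sum n \<iota> x h \<in> centralizer (\<iota> ` ?A) \<longleftrightarrow>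
      (\<forall>\<alpha>\<in>multi_indices n. \<forall>\<omega>\<in>Sep t N n \<sigma> \<alpha>. mu_inv t N (h \<alpha>) \<omega> = 0)"
    if h: "h \<in> coeff_families ?A n" for h
  proof -
    let ?s = "comp_power n (\<lambda>i. induced_aut (\<sigma> i))"
    have hA: "h \<alpha> \<in> ?A" for \<alpha> using h by (simp add: coeff_families_def)
    have h0: "h \<alpha> = 0" if "\<alpha> \<notin> multi_indices n" for \<alpha>
      using h that by (auto simp: coeff_families_def)
    have "pbw_sum n \<iota> x h \<in> centralizer (\<iota> ` ?A) \<longleftrightarrow> (\<forall>a\<in>?A. \<forall>\<alpha>. h \<alpha> * ?s \<alpha> a = a * h \<alpha>)"
      using commute_coefficient_iff[OF ring aut h] by (simp add: centralizer_def)
    \<comment> \<open>Off \<open>multi_indices n\<close> the coefficient is 0 and the equation is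
      trivial.\<close>
    also have "\<dots> \<longleftrightarrow> (\<forall>\<alpha>\<in>multi_indices n. \<forall>a\<in>?A. h \<alpha> * ?s \<alpha> a = a * h \<alpha>)"
      using h0 by (metis mult_zero_left mult_zero_right)
    also have "\<dots> \<longleftrightarrow> (\<forall>\<alpha>\<in>multi_indices n. \<forall>\<omega>\<in>Sep t N n \<sigma> \<alpha>. mu_inv t N (h \<alpha>) \<omega> = 0)"
      using vanishes_on_Sep_iff[OF assms(1-3) hA] by simp
    finally show ?thesis .
  qed
  show ?thesis
  proof (intro equalityI subsetI)
    fix r assume r: "r \<in> centralizer (\<iota> ` ?A)"
    obtain h where "h \<in> coeff_families ?A n" "r = pbw_sum n \<iota> x h" using spanning[of r] by blast
    then show "r \<in> {pbw_sum n \<iota> x h | h. h \<in> coeff_families ?A n \<and>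
       (\<forall>\<alpha>\<in>multi_indices n. \<forall>\<omega>\<in>Sep t N n \<sigma> \<alpha>. mu_inv t N (h \<alpha>) \<omega> = 0)}"
      using key[of h] r by blast
  qed (use key in auto)
qed

end
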